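(* Let $n,m$ be integers with $2\leq n\leq m$. Then $sn(K_2\square K_n\square K_m)=\operatorname{gon}(K_2\square K_n\square K_m)=nm$.
   Context: $K_n$ is the complete graph on $n$ vertices. $G\square H$ is the Cartesian product of graphs: vertices are pairs $(x,y)$ with $x\in V(G)$, $y\in V(H)$; $(x,y_1)\sim(x,y_2)$ when $y_1\sim y_2$ in $H$, and $(x_1,y)\sim(x_2,y)$ when $x_1\sim x_2$ in $G$. Let $G$ be a finite connected loopless graph (multiple edges allowed). Gonality: a divisor on $G$ is an integer vector $D\in\mathbb{Z}^{V(G)}$ (the coordinate $D(v)$ is thought of as the number of chips on $v$); its degree is $\deg(D)=\sum_v D(v)$; it is effective if $D(v)\ge 0$ for all $v$. Firing a vertex $v$ transforms a divisor by moving one chip from $v$ along each edge incident to $v$ to the other endpoint of that edge. Two divisors are equivalent if one can be obtained from the other by a finite sequence of vertex firings. A divisor $D$ has rank at least $r$ if for every effective divisor $E$ of degree $r$, $D-E$ is equivalent to an effective divisor. The gonality $\operatorname{gon}(G)$ is the minimum degree of a divisor on $G$ of rank at least $1$. Scramble number: a scramble $S$ on $G$ is a collection of non-empty vertex subsets of $G$, called eggs, each of which is connected (i.e. induces a connected subgraph). A hitting set of $S$ is a set $H\subseteq V(G)$ with $H\cap E\ne\emptyset$ for every egg $E$ of $S$. An egg cut of $S$ is a partition $V(G)=X\sqcup Y$ such that there are eggs $E_1\subseteq X$ and $E_2\subseteq Y$; its egg cut set is $E(X,Y)$, the set of edges with one end in $X$ and the other in $Y$. The order $\|S\|$ is the minimum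 of the smallest size $|H|$ of a hitting set of $S$ and the smallest size $|E(X,Y)|$ of an egg cut set of $S$ (if $S$ has no egg cut, the order is the smallest size of a hitting set). The scramble number $sn(G)$ is the largest order of a scramble on $G$. *)

theory Defs
  imports "Graph_Theory.Graph_Theory"
begin

text \<open>
  Undirected graphs follow the convention of the Graph Theory entry: an undirected edge between
  u and v is represented by two opposite arcs, one from u to v and one from v to u, and parallel
  edges are represented by parallel pairs of such arcs. Consequently the number of
  edges between two distinct vertices u and v is the number of arcs with tail u and head v, and
  the number of edges between disjoint vertex sets X and Y is the number of arcs with tail in X
  and head in Y.
\<close>

section \<open>Cartesian products\<close>

text \<open>
  The arc (x, b) joins (x, y1) to (x, y2) if b joins y1 to y2 in H, and the arc (a, y) joins
  (x1, y) to (x2, y) if a joins x1 to x2 in G.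
\<close>

definition cart_prod ::
  "('a, 'b) pre_digraph \<Rightarrow> ('c, 'd) pre_digraph \<Rightarrow> ('a \<times> 'c, 'a \<times> 'd + 'b \<times> 'c) pre_digraph"
  (infixl \<open>\<box>\<close> 70) where
  "G \<box> H = \<lparr>verts = verts G \<times> verts H,
            arcs = (verts G \<times> arcs H) <+> (arcs G \<times> verts H),
            tail = case_sum (\<lambda>(x, b). (x, tail H b)) (\<lambda>(a, y). (tail G a, y)),
            head = case_sum (\<lambda>(x, b). (x, head H b)) (\<lambda>(a, y). (head G a, y))\<rparr>"

section \<open>Gonality\<close>

text \<open>Divisors, i.e. integer vectors indexed by the vertices, are functions vanishing elsewhere.\<close>

definition divisors :: "('a, 'b) pre_digraph \<Rightarrow> ('a \<Rightarrow> int) set" where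
  "divisors G = {D. \<forall>v. v \<notin> verts G \<longrightarrow> D v = 0}"

definition div_degree :: "('a, 'b) pre_digraph \<Rightarrow> ('a \<Rightarrow> int) \<Rightarrow> int" where
  "div_degree G D = (\<Sum>v\<in>verts G. D v)"

definition effective :: "('a, 'b) pre_digraph \<Rightarrow> ('a \<Rightarrow> int) \<Rightarrow> bool" where
  "effective G D \<longleftrightarrow> (\<forall>v\<in>verts G. 0 \<le> D v)"

definition fire :: "('a, 'b) pre_digraph \<Rightarrow> 'a \<Rightarrow> ('a \<Rightarrow> int) \<Rightarrow> 'a \<Rightarrow> int" where
  "fire G v D = (\<lambda>w. D w - (if w = v then int (card (out_arcs G v)) else 0)
                         + int (card {a \<in> out_arcs G v. head G a = w}))"

definition firing_step :: "('a, 'b) pre_digraph \<Rightarrow> ('a \<Rightarrow> int) \<Rightarrow> ('a \<Rightarrow> int) \<Rightarrow> bool" where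
  "firing_step G D D' \<longleftrightarrow> (\<exists>v\<in>verts G. D' = fire G v D)"

definition div_equiv :: "('a, 'b) pre_digraph \<Rightarrow> ('a \<Rightarrow> int) \<Rightarrow> ('a \<Rightarrow> int) \<Rightarrow> bool" where
  "div_equiv G D D' \<longleftrightarrow> (firing_step G)\<^sup>*\<^sup>* D D' \<or> (firing_step G)\<^sup>*\<^sup>* D' D"

definition rank_at_least :: "('a, 'b) pre_digraph \<Rightarrow> ('a \<Rightarrow> int) \<Rightarrow> nat \<Rightarrow> bool" where
  "rank_at_least G D r \<longleftrightarrow>
     (\<forall>E\<in>divisors G. effective G E \<and> div_degree G E = int r \<longrightarrow>
        (\<exists>F\<in>divisors G. effective G F \<and> div_equiv G (\<lambda>v. D v - E v) F))"

definition gon :: "('a, 'b) pre_digraph \<Rightarrow> int" where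
  "gon G = (LEAST d. \<exists>D\<in>divisors G. div_degree G D = d \<and> rank_at_least G D 1)"

section \<open>Scramble number\<close>

definition scramble :: "('a, 'b) pre_digraph \<Rightarrow> 'a set set \<Rightarrow> bool" where
  "scramble G S \<longleftrightarrow> (\<forall>E\<in>S. E \<noteq> {} \<and> E \<subseteq> verts G \<and> connected (G \<restriction> E))"

definition hitting_set :: "('a, 'b) pre_digraph \<Rightarrow> 'a set set \<Rightarrow> 'a set \<Rightarrow> bool" where
  "hitting_set G S H \<longleftrightarrow> H \<subseteq> verts G \<and> (\<forall>E\<in>S. H \<inter> E \<noteq> {})"

definition egg_cut :: "('a, 'b) pre_digraph \<Rightarrow> 'a set set \<Rightarrow> 'a set \<Rightarrow> 'a set \<Rightarrow> bool" where
  "egg_cut G S X Y \<longleftrightarrow>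
     X \<union> Y = verts G \<and> X \<inter> Y = {} \<and> (\<exists>E1\<in>S. E1 \<subseteq> X) \<and> (\<exists>E2\<in>S. E2 \<subseteq> Y)"

text \<open>
  For disjoint X and Y, each edge between X and Y is counted once below, through the one of its
  two arcs that leads from X to Y.
\<close>

definition cut_edges :: "('a, 'b) pre_digraph \<Rightarrow> 'a set \<Rightarrow> 'a set \<Rightarrow> 'b set" where
  "cut_edges G X Y = {a \<in> arcs G. tail G a \<in> X \<and> head G a \<in> Y}"

definition hitting_number :: "('a, 'b) pre_digraph \<Rightarrow> 'a set set \<Rightarrow> nat" where
  "hitting_number G S = (LEAST k. \<exists>H. hitting_set G S H \<and> card H = k)"

definition egg_cut_number :: "('a, 'b) pre_digraph \<Rightarrow> 'a set set \<Rightarrow> nat" where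
  "egg_cut_number G S = (LEAST k. \<exists>X Y. egg_cut G S X Y \<and> card (cut_edges G X Y) = k)"

definition scramble_order :: "('a, 'b) pre_digraph \<Rightarrow> 'a set set \<Rightarrow> nat" where
  "scramble_order G S =
     (if \<exists>X Y. egg_cut G S X Y then min (hitting_number G S) (egg_cut_number G S)
      else hitting_number G S)"

definition sn :: "('a, 'b) pre_digraph \<Rightarrow> nat" where
  "sn G = Max {scramble_order G S | S. scramble G S}"

section \<open>Basic facts\<close>

lemma cart_prod_simps [simp]:
  "verts (G \<box> H) = verts G \<times> verts H"
  "arcs (G \<box> H) = (verts G \<times> arcs H) <+> (arcs G \<times> verts H)"
  "tail (G \<box> H) (Inl (x, b)) = (x, tail H b)"
  "tail (G \<box> H) (Inr (a, y)) = (tail G a, y)"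
  "head (G \<box> H) (Inl (x, b)) = (x, head H b)"
  "head (G \<box> H) (Inr (a, y)) = (head G a, y)"
  by (simp_all add: cart_prod_def)

lemma arcs_ends_cart_prod:
  "((x1, y1), (x2, y2)) \<in> arcs_ends (G \<box> H) \<longleftrightarrow>
     x1 = x2 \<and> x1 \<in> verts G \<and> (y1, y2) \<in> arcs_ends H \<or>
     y1 = y2 \<and> y1 \<in> verts H \<and> (x1, x2) \<in> arcs_ends G"
  by (force simp: arcs_ends_def arc_to_ends_def image_iff Plus_def)

lemma graph_cart_prod:
  assumes "graph G" "graph H"
  shows "graph (G \<box> H)"
proof -
  interpret G: graph G by fact
  interpret H: graph H by fact
  have "symmetric (G \<box> H)"
    using G.graph_symmetric H.graph_symmetric
    by (auto simp: symmetric_def arcs_ends_cart_prod intro!: symI)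
  then show ?thesis
    by unfold_locales
       (auto simp: arc_to_ends_def dest: G.no_loops H.no_loops
             intro: G.no_multi_arcs H.no_multi_arcs)
qed

lemma finite_scramble_orders:
  assumes "finite (verts G)"
  shows "finite {scramble_order G S | S. scramble G S}"
proof -
  have "{S. scramble G S} \<subseteq> Pow (Pow (verts G))"
    by (auto simp: scramble_def)
  then have "finite {S. scramble G S}"
    using assms by (meson finite_Pow_iff finite_subset)
  then show ?thesis by (simp add: setcompr_eq_image)
qed

end

theory Submission
  imports Defs
begin

text \<open>
  Upper bound: put one chip on each vertex of one of the two layers of the product; firing that layer
  moves all chips to the other one. Any divisor of rank at least 1 has degree at least the order of any
  scramble: among its effective representatives take one hitting as many eggs as possible, and walk from it
  to a representative hitting a missed egg by firing the level sets of the firing script. At the moment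
  this egg gets hit, some other egg must already have been lost, so the set being fired separates the two
  eggs, and the edges across it cannot outnumber the chips.

  Lower bound: the eggs are the stars with at least n vertices. If fewer than nm vertices are removed, one
  layer retains more than half of its vertices, and averaging finds in it a vertex whose row and column
  together retain at least n vertices. Egg cuts have at least n vertices on each side, and the edge
  isoperimetric inequality for two copies of the rook's graph on an n by m board shows that they have at
  least nm edges.
\<close>

section \<open>Scrambles bound the degree of divisors of positive rank\<close>

text \<open>Summing over end pairs instead of arcs is faithful because \<open>graph\<close> excludes
  parallel arcs. Firing each vertex \<open>u\<close> in total \<open>f u\<close> times turns
  \<open>D\<close> into \<open>D - laplacian G f\<close>; negative values stand for firings
  undone.\<close>

definition laplacian :: "('a, 'b) pre_digraph \<Rightarrow> ('a \<Rightarrow> int) \<Rightarrow> 'a \<Rightarrow> int" where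
  "laplacian G f v = (\<Sum>u | (v, u) \<in> arcs_ends G. f v - f u)"

section \<open>Algebra of the Laplacian\<close>

context graph
begin

lemma arcs_ends_verts: "(u, v) \<in> arcs_ends G \<Longrightarrow> u \<in> verts G \<and> v \<in> verts G"
  by (auto simp: arcs_ends_def arc_to_ends_def)

lemma finite_neighbours_such_that: "finite {u. (v, u) \<in> arcs_ends G \<and> P u}"
  by (rule finite_subset[OF _ finite_verts]) (auto dest: arcs_ends_verts)

lemma finite_neighbours [simp]: "finite {u. (v, u) \<in> arcs_ends G}"
  using finite_neighbours_such_that[of v "\<lambda>_. True"] by simp

lemma arcs_ends_irrefl [simp]: "(v, v) \<notin> arcs_ends G"
  by (auto simp: arcs_ends_def arc_to_ends_def dest: no_loops)

lemma arcs_ends_sym: "(u, v) \<in> arcs_ends G \<longleftrightarrow> (v, u) \<in> arcs_ends G"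
  using graph_symmetric by blast

lemma laplacian_diff: "laplacian G (\<lambda>u. f u - g u) v = laplacian G f v - laplacian G g v"
  by (simp add: laplacian_def flip: sum_subtractf) (simp add: algebra_simps)

lemma laplacian_add: "laplacian G (\<lambda>u. f u + g u) v = laplacian G f v + laplacian G g v"
  by (simp add: laplacian_def flip: sum.distrib) (simp add: algebra_simps)

lemma laplacian_uminus: "laplacian G (\<lambda>u. - f u) v = - laplacian G f v"
  by (simp add: laplacian_def flip: sum_negf)

lemma laplacian_const [simp]: "laplacian G (\<lambda>u. c) v = 0"
  by (simp add: laplacian_def)

lemma laplacian_notin_verts: "v \<notin> verts G \<Longrightarrow> laplacian G f v = 0"
  unfolding laplacian_def by (rule sum.neutral) (auto dest: arcs_ends_verts)

lemma laplacian_cong: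
  assumes "\<And>u. u \<in> verts G \<Longrightarrow> f u = g u"
  shows "laplacian G f v = laplacian G g v"
  unfolding laplacian_def by (rule sum.cong) (auto simp: assms dest!: arcs_ends_verts)

lemma laplacian_indicator_in:
  assumes "v \<in> U"
  shows "laplacian G (\<lambda>u. of_bool (u \<in> U)) v = int (card {u. (v, u) \<in> arcs_ends G \<and> u \<notin> U})"
proof -
  have "laplacian G (\<lambda>u. of_bool (u \<in> U)) v
      = (\<Sum>u | (v, u) \<in> arcs_ends G. if u \<notin> U then 1 else 0)"
    unfolding laplacian_def using assms by (intro sum.cong) auto
  then show ?thesis
    by (simp add: Int_def conj_commute flip: sum.inter_filter)
qed

lemma laplacian_indicator_notin:
  assumes "v \<notin> U"
  shows "laplacian G (\<lambda>u. of_bool (u \<in> U)) v = - int (card {u. (v, u) \<in> arcs_ends G \<and> u \<in> U})"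
proof -
  have "laplacian G (\<lambda>u. of_bool (u \<in> U)) v
      = - (\<Sum>u | (v, u) \<in> arcs_ends G. if u \<in> U then 1 else 0)"
    unfolding laplacian_def using assms by (subst sum_negf[symmetric], intro sum.cong) auto
  then show ?thesis
    by (simp add: Int_def conj_commute flip: sum.inter_filter)
qed

lemma sum_arcs_ends:
  assumes "finite X"
  shows "(\<Sum>v\<in>X. \<Sum>u | (v, u) \<in> arcs_ends G \<and> P u. h v u)
    = (\<Sum>(v, u) | (v, u) \<in> arcs_ends G \<and> v \<in> X \<and> P u. h v u)"
proof -
  have "(SIGMA v:X. {u. (v, u) \<in> arcs_ends G \<and> P u})
      = {(v, u). (v, u) \<in> arcs_ends G \<and> v \<in> X \<and> P u}"
    by auto
  then show ?thesis
    using assms by (subst sum.Sigma) (auto intro: finite_neighbours_such_that)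
qed

text \<open>The two ends of an edge contribute opposite amounts. Hence firing preserves the
  degree.\<close>

lemma sum_laplacian: "(\<Sum>v\<in>verts G. laplacian G f v) = 0"
proof -
  have eq: "{(v, u). (v, u) \<in> arcs_ends G \<and> v \<in> verts G} = arcs_ends G"
    by (auto dest: arcs_ends_verts)
  have "(\<Sum>v\<in>verts G. laplacian G f v) = (\<Sum>(v, u)\<in>arcs_ends G. f v - f u)"
    unfolding laplacian_def
    using sum_arcs_ends[of "verts G" "\<lambda>v u. f v - f u" "\<lambda>_. True"] by (simp add: eq)
  also have "\<dots> = (\<Sum>(v, u)\<in>arcs_ends G. f v) - (\<Sum>(v, u)\<in>arcs_ends G. f u)"
    by (simp add: case_prod_unfold sum_subtractf)
  also have "(\<Sum>(v, u)\<in>arcs_ends G. f u) = (\<Sum>(v, u)\<in>arcs_ends G. f v)"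
    by (rule sum.reindex_bij_witness[where i = prod.swap and j = prod.swap])
       (auto simp: arcs_ends_sym)
  finally show ?thesis by simp
qed

lemma card_cut_edges:
  assumes "finite X"
  shows "card (cut_edges G X Y) = (\<Sum>v\<in>X. card {u. (v, u) \<in> arcs_ends G \<and> u \<in> Y})"
proof -
  have "bij_betw (arc_to_ends G) (cut_edges G X Y)
      {(v, u). (v, u) \<in> arcs_ends G \<and> v \<in> X \<and> u \<in> Y}"
    unfolding bij_betw_def
  proof
    show "inj_on (arc_to_ends G) (cut_edges G X Y)"
      by (rule inj_on_subset[OF inj_on_arc_to_ends]) (auto simp: cut_edges_def)
  qed (auto simp: cut_edges_def arcs_ends_def arc_to_ends_def image_iff)
  then have "card (cut_edges G X Y) = card {(v, u). (v, u) \<in> arcs_ends G \<and> v \<in> X \<and> u \<in> Y}"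
    by (rule bij_betw_same_card)
  also have "\<dots> = (\<Sum>v\<in>X. card {u. (v, u) \<in> arcs_ends G \<and> u \<in> Y})"
    using sum_arcs_ends[OF assms, of "\<lambda>_ _. 1::nat" "\<lambda>u. u \<in> Y"] by (simp add: case_prod_unfold)
  finally show ?thesis .
qed

section \<open>Chip firing as subtraction of a Laplacian\<close>

lemma fire_eq_laplacian:
  "fire G v D = (\<lambda>w. D w - laplacian G (\<lambda>u. of_bool (u \<in> {v})) w)"
proof
  fix w
  \<comment> \<open>Without parallel arcs, counting arcs that leave \<open>v\<close> is counting
    neighbours.\<close>
  have inj: "inj_on (head G) (out_arcs G v)"
    by (rule inj_onI) (auto simp: arc_to_ends_def intro: no_multi_arcs)
  have img: "head G ` {a \<in> out_arcs G v. P (head G a)} = {u. (v, u) \<in> arcs_ends G \<and> P u}" for P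
    by (auto simp: arcs_ends_def arc_to_ends_def)
  have card: "card {a \<in> out_arcs G v. P (head G a)} = card {u. (v, u) \<in> arcs_ends G \<and> P u}" for P
    unfolding img[symmetric] by (rule card_image[symmetric], rule inj_on_subset[OF inj]) auto
  show "fire G v D w = D w - laplacian G (\<lambda>u. of_bool (u \<in> {v})) w"
  proof (cases "w = v")
    case True
    have [simp]: "{u. (v, u) \<in> arcs_ends G \<and> u \<noteq> v} = {u. (v, u) \<in> arcs_ends G}"
      by auto
    have [simp]: "{u. u = v \<and> (v, u) \<in> arcs_ends G} = {}"
      by auto
    show ?thesis
      using True card[of "\<lambda>_. True"] card[of "\<lambda>u. u = v"] laplacian_indicator_in[of v "{v}"]
      by (simp add: fire_def out_arcs_def)
  next
    case False
    have "{u. (v, u) \<in> arcs_ends G \<and> u = w} = (if (v, w) \<in> arcs_ends G then {w} else {})"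
      and "{u. (w, u) \<in> arcs_ends G \<and> u = v} = (if (v, w) \<in> arcs_ends G then {v} else {})"
      using arcs_ends_sym by auto
    then show ?thesis
      using False card[of "\<lambda>u. u = w"] laplacian_indicator_notin[of w "{v}"]
      by (simp add: fire_def)
  qed
qed

lemma firing_steps_laplacian:
  assumes "(firing_step G)\<^sup>*\<^sup>* D D'"
  shows "\<exists>f. D' = (\<lambda>w. D w - laplacian G f w)"
  using assms
proof induction
  case base
  show ?case by (rule exI[of _ "\<lambda>_. 0"]) simp
next
  case (step D' D'')
  then obtain f v where "D' = (\<lambda>w. D w - laplacian G f w)"
    and "D'' = (\<lambda>w. D' w - laplacian G (\<lambda>u. of_bool (u \<in> {v})) w)"
    by (auto simp: firing_step_def fire_eq_laplacian)
  then show ?case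
    by (intro exI[of _ "\<lambda>w. f w + of_bool (w \<in> {v})"]) (simp add: laplacian_add fun_eq_iff)
qed

text \<open>A firing sequence run backwards is given by the negated script.\<close>

lemma div_equiv_laplacian:
  assumes "div_equiv G D D'"
  shows "\<exists>f. D' = (\<lambda>w. D w - laplacian G f w)"
proof -
  consider "(firing_step G)\<^sup>*\<^sup>* D D'" | "(firing_step G)\<^sup>*\<^sup>* D' D"
    using assms by (auto simp: div_equiv_def)
  then show ?thesis
  proof cases
    case 1
    then show ?thesis by (rule firing_steps_laplacian)
  next
    case 2
    then obtain f where "D = (\<lambda>w. D' w - laplacian G f w)"
      using firing_steps_laplacian by blast
    then show ?thesis
      by (intro exI[of _ "\<lambda>w. - f w"]) (simp add: laplacian_uminus)
  qed
qed

text \<open>The vertices of \<open>U\<close> fire one by one; debts on the way are harmless, since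
  equivalence does not ask for effectiveness.\<close>

lemma firing_steps_set:
  assumes "U \<subseteq> verts G"
  shows "(firing_step G)\<^sup>*\<^sup>* D (\<lambda>w. D w - laplacian G (\<lambda>u. of_bool (u \<in> U)) w)"
  using finite_subset[OF assms finite_verts] assms
proof (induction U)
  case empty
  then show ?case by simp
next
  case (insert v U)
  let ?D = "\<lambda>w. D w - laplacian G (\<lambda>u. of_bool (u \<in> U)) w"
  have "laplacian G (\<lambda>u. of_bool (u \<in> insert v U)) w
      = laplacian G (\<lambda>u. of_bool (u \<in> U)) w + laplacian G (\<lambda>u. of_bool (u \<in> {v})) w" for w
    unfolding laplacian_add[symmetric] by (rule laplacian_cong) (use insert.hyps in auto)
  then have "fire G v ?D = (\<lambda>w. D w - laplacian G (\<lambda>u. of_bool (u \<in> insert v U)) w)"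
    unfolding fire_eq_laplacian by (simp add: diff_diff_eq)
  then have "firing_step G ?D (\<lambda>w. D w - laplacian G (\<lambda>u. of_bool (u \<in> insert v U)) w)"
    using insert.prems unfolding firing_step_def by (metis insert_subset)
  then show ?case
    using insert.IH insert.prems by (meson insert_subset rtranclp.rtrancl_into_rtrancl)
qed

section \<open>Eggs gained and lost when a set fires\<close>

lemma connected_cut_edge:
  assumes "connected (G \<restriction> E)" "E \<inter> U \<noteq> {}" "\<not> E \<subseteq> U"
  obtains u w where "u \<in> E \<inter> U" "w \<in> E - U" "(u, w) \<in> arcs_ends G"
proof -
  obtain x y where xy: "x \<in> E \<inter> U" "y \<in> E - U"
    using assms by auto
  have ends: "arcs_ends (G \<restriction> E) \<subseteq> arcs_ends G \<inter> E \<times> E"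
    by (auto simp: arcs_ends_def arc_to_ends_def)
  have "(x, y) \<in> rtrancl_on E ((arcs_ends (G \<restriction> E))\<^sup>s)"
    using assms(1) xy by (auto simp: connected_conv)
  then have "(x, y) \<in> ((arcs_ends (G \<restriction> E))\<^sup>s)\<^sup>*"
    by (rule rtrancl_on_rtranclI)
  then have "y \<in> U \<or> (\<exists>u w. u \<in> E \<inter> U \<and> w \<in> E - U \<and> (u, w) \<in> arcs_ends G)"
  proof (induction rule: rtrancl_induct)
    case base
    then show ?case using xy by simp
  next
    case (step y z)
    have "(y, z) \<in> arcs_ends G \<and> y \<in> E \<and> z \<in> E"
      using step.hyps(2) ends arcs_ends_sym by (auto simp: symcl_def)
    then show ?case using step.IH by blast
  qed
  then show ?thesis using xy that by auto
qed

text \<open>A chipless vertex of \<open>U\<close> with a neighbour outside \<open>U\<close> would go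
  into debt. By connectedness an egg meeting \<open>U\<close> either has such a vertex or lies
  inside \<open>U\<close>, where firing brings no chips.\<close>

lemma unhit_before_firing:
  assumes "connected (G \<restriction> E)" "E \<subseteq> verts G"
    and "\<And>v. v \<in> E \<Longrightarrow> D v = 0"
    and D': "D' = (\<lambda>w. D w - laplacian G (\<lambda>u. of_bool (u \<in> U)) w)" "effective G D'"
    and "\<exists>v\<in>E. 0 < D' v"
  shows "E \<inter> U = {}"
proof (rule ccontr)
  assume "E \<inter> U \<noteq> {}"
  show False
  proof (cases "E \<subseteq> U")
    case True
    then have "D' v \<le> 0" if "v \<in> E" for v
      using that assms(3) by (auto simp: D' laplacian_indicator_in)
    then show ?thesis
      using assms(6) by force
  next
    case False
    then obtain u w where uw: "u \<in> E \<inter> U" "w \<in> E - U" "(u, w) \<in> arcs_ends G"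
      using connected_cut_edge assms(1) \<open>E \<inter> U \<noteq> {}\<close> by blast
    have "0 < card {w. (u, w) \<in> arcs_ends G \<and> w \<notin> U}"
      using uw finite_neighbours_such_that by (auto simp: card_gt_0_iff)
    then have "D' u < 0"
      using uw assms(3) by (simp add: D' laplacian_indicator_in)
    then show False
      using uw assms(2) D'(2) by (force simp: effective_def)
  qed
qed

text \<open>Firing \<open>U\<close> is undone by firing its complement, since the two indicators add
  up to a constant; so this is the preceding situation with time reversed.\<close>

lemma unhit_after_firing:
  assumes "connected (G \<restriction> E)" "E \<subseteq> verts G"
    and "\<And>v. v \<in> E \<Longrightarrow> D' v = 0"
    and D': "D' = (\<lambda>w. D w - laplacian G (\<lambda>u. of_bool (u \<in> U)) w)"
    and "effective G D" "\<exists>v\<in>E. 0 < D v"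
  shows "E \<subseteq> U"
proof -
  have "laplacian G (\<lambda>u. of_bool (u \<in> - U)) w
      = laplacian G (\<lambda>u. 1 - of_bool (u \<in> U)) w" for w
    by (rule laplacian_cong) auto
  then have "D = (\<lambda>w. D' w - laplacian G (\<lambda>u. of_bool (u \<in> - U)) w)"
    by (simp add: D' laplacian_diff)
  then have "E \<inter> - U = {}"
    using unhit_before_firing assms by blast
  then show ?thesis by blast
qed

text \<open>Each vertex of \<open>X\<close> pays one chip per edge leaving \<open>X\<close>; ending
  without debt, it must own these chips beforehand.\<close>

lemma card_cut_edges_le_degree:
  assumes "X \<subseteq> verts G" "effective G D"
    and "effective G (\<lambda>w. D w - laplacian G (\<lambda>u. of_bool (u \<in> X)) w)"
  shows "int (card (cut_edges G X (verts G - X))) \<le> div_degree G D"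
proof -
  have fin: "finite X"
    using assms(1) finite_verts by (rule finite_subset)
  have "int (card (cut_edges G X (verts G - X)))
      = (\<Sum>v\<in>X. int (card {u. (v, u) \<in> arcs_ends G \<and> u \<in> verts G - X}))"
    by (simp add: card_cut_edges[OF fin])
  also have "\<dots> = (\<Sum>v\<in>X. laplacian G (\<lambda>u. of_bool (u \<in> X)) v)"
  proof (rule sum.cong[OF refl])
    fix v assume "v \<in> X"
    moreover have "{u. (v, u) \<in> arcs_ends G \<and> u \<in> verts G - X} = {u. (v, u) \<in> arcs_ends G \<and> u \<notin> X}"
      by (auto dest: arcs_ends_verts)
    ultimately show "int (card {u. (v, u) \<in> arcs_ends G \<and> u \<in> verts G - X})
        = laplacian G (\<lambda>u. of_bool (u \<in> X)) v"
      by (simp add: laplacian_indicator_in)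
  qed
  also have "\<dots> \<le> (\<Sum>v\<in>X. D v)"
    using assms by (intro sum_mono) (auto simp: effective_def)
  also have "\<dots> \<le> div_degree G D"
    unfolding div_degree_def using assms by (intro sum_mono2) (auto simp: effective_def)
  finally show ?thesis .
qed

text \<open>
  Lowering t means firing the level sets of f one after the other, from the top; so the way from
  one effective divisor to another never leaves the effective divisors.
\<close>

lemma effective_truncated_firing:
  assumes "effective G D" "effective G (\<lambda>w. D w - laplacian G f w)"
  shows "effective G (\<lambda>w. D w - laplacian G (\<lambda>u. max (f u) t) w)"
  unfolding effective_def
proof
  fix w assume w: "w \<in> verts G"
  show "0 \<le> D w - laplacian G (\<lambda>u. max (f u) t) w"
  \<comment> \<open>A vertex at or below the cutoff only gains chips compared with \<open>D\<close>.
    Above it, truncation raises nothing but neighbours, which lowers the Laplacian.\<close>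
  proof (cases "f w \<le> t")
    case True
    then have "laplacian G (\<lambda>u. max (f u) t) w \<le> 0"
      unfolding laplacian_def by (intro sum_nonpos) auto
    then show ?thesis
      using assms(1) w by (force simp: effective_def)
  next
    case False
    then have "laplacian G (\<lambda>u. max (f u) t) w \<le> laplacian G f w"
      unfolding laplacian_def by (intro sum_mono) auto
    then show ?thesis
      using assms(2) w by (force simp: effective_def)
  qed
qed

section \<open>Positive rank against scrambles\<close>

lemma rank_at_least_1D:
  assumes "rank_at_least G D 1" "v \<in> verts G"
  shows "\<exists>f. effective G (\<lambda>w. D w - laplacian G f w) \<and> 0 < D v - laplacian G f v"
proof -
  let ?E = "\<lambda>w. of_bool (w = v) :: int"
  have "?E \<in> divisors G" "effective G ?E" "div_degree G ?E = int 1"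
    using assms(2) by (auto simp: divisors_def effective_def div_degree_def of_bool_def)
  then obtain F where F: "effective G F" "div_equiv G (\<lambda>w. D w - ?E w) F"
    using assms(1) unfolding rank_at_least_def by blast
  then obtain f where f: "F = (\<lambda>w. D w - ?E w - laplacian G f w)"
    using div_equiv_laplacian by blast
  have "D w - laplacian G f w = F w + ?E w" for w
    by (simp add: f)
  then show ?thesis
    using F(1) assms(2) by (intro exI[of _ f]) (auto simp: effective_def intro!: add_nonneg_pos)
qed

lemma scramble_order_le_degree:
  assumes S: "scramble G S" and D: "rank_at_least G D 1" and "verts G \<noteq> {}"
  shows "int (scramble_order G S) \<le> div_degree G D"
proof (rule ccontr)
  assume "\<not> int (scramble_order G S) \<le> div_degree G D"
  then have less_hit: "div_degree G D < int (hitting_number G S)"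
    and less_cut: "\<And>X Y. egg_cut G S X Y \<Longrightarrow> div_degree G D < int (egg_cut_number G S)"
    by (auto simp: scramble_order_def split: if_splits)
  have egg: "E \<noteq> {}" "E \<subseteq> verts G" "connected (G \<restriction> E)" if "E \<in> S" for E
    using S that by (auto simp: scramble_def)
  have "S \<subseteq> Pow (verts G)"
    using egg by auto
  then have fin_S: "finite S"
    by (rule finite_subset) simp
  define hits where "hits F = {E \<in> S. \<exists>v\<in>E. 0 < F v}" for F :: "'a \<Rightarrow> int"
  define P where "P f \<longleftrightarrow> effective G (\<lambda>w. D w - laplacian G f w)" for f
  obtain f0 where "P f0"
    using rank_at_least_1D[OF D] assms(3) by (auto simp: P_def)
  moreover have "card (hits F) \<le> card S" for F
    unfolding hits_def by (rule card_mono[OF fin_S]) auto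
  \<comment> \<open>Extremal choice: among the scripts leading from \<open>D\<close> to effective
    divisors, \<open>g\<close> maximises the number of eggs hit.\<close>
  ultimately have "\<exists>g. P g \<and> (\<forall>f. P f \<longrightarrow>
      card (hits (\<lambda>w. D w - laplacian G f w)) \<le> card (hits (\<lambda>w. D w - laplacian G g w)))"
    by (intro ex_has_greatest_nat[where k = f0 and b = "Suc (card S)"]) (auto simp: less_Suc_eq_le)
  then obtain g where g: "P g"
    and g_max: "\<And>f. P f \<Longrightarrow> card (hits (\<lambda>w. D w - laplacian G f w)) \<le> card (hits (\<lambda>w. D w - laplacian G g w))"
    by blast
  define D0 where "D0 = (\<lambda>w. D w - laplacian G g w)"
  have D0: "effective G D0"
    using g by (simp add: P_def D0_def)
  have deg: "div_degree G (\<lambda>w. D w - laplacian G f w) = div_degree G D" for f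
    by (simp add: div_degree_def sum_subtractf sum_laplacian)
  \<comment> \<open>The support of \<open>D0\<close> is smaller than every hitting set, so it misses
    an egg \<open>E\<close>.\<close>
  define T where "T = {v \<in> verts G. 0 < D0 v}"
  have "int (card T) = (\<Sum>v\<in>T. 1)"
    by simp
  also have "\<dots> \<le> (\<Sum>v\<in>T. D0 v)"
    by (rule sum_mono) (auto simp: T_def)
  also have "\<dots> \<le> div_degree G D0"
    unfolding div_degree_def
    by (rule sum_mono2) (use D0 in \<open>auto simp: T_def effective_def\<close>)
  finally have "int (card T) < int (hitting_number G S)"
    using less_hit deg[of g] by (simp add: D0_def)
  then have "\<not> hitting_set G S T"
    unfolding hitting_number_def using not_less_Least by fastforce
  then obtain E where E: "E \<in> S" "T \<inter> E = {}"
    by (auto simp: hitting_set_def T_def)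
  have D0_E: "D0 v = 0" if "v \<in> E" for v
  proof -
    have "v \<in> verts G"
      using egg(2)[OF E(1)] that by auto
    then show ?thesis
      using E(2) D0 that by (force simp: T_def effective_def)
  qed
  obtain v where v: "v \<in> E" "v \<in> verts G"
    using egg[OF E(1)] by auto
  obtain h where h: "P h" "0 < D v - laplacian G h v"
    using rank_at_least_1D[OF D v(2)] by (auto simp: P_def)
  define f where "f = (\<lambda>u. h u - g u)"
  have f: "effective G (\<lambda>w. D0 w - laplacian G f w)" "0 < D0 v - laplacian G f v"
    using h by (simp_all add: D0_def P_def f_def laplacian_diff)
  \<comment> \<open>\<open>C k\<close> is the divisor after firing \<open>k\<close> level sets of
    \<open>f\<close> from the top value \<open>M\<close> downwards; \<open>U k\<close> is the set
    fired next.\<close>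
  define M where "M = Max (f ` verts G)"
  define C where "C k = (\<lambda>w. D0 w - laplacian G (\<lambda>u. max (f u) (M - int k)) w)" for k
  define U where "U k = {u \<in> verts G. M - int k \<le> f u}" for k
  have C_eff: "effective G (C k)" for k
    unfolding C_def by (rule effective_truncated_firing[OF D0 f(1)])
  have C_max: "card (hits (C k)) \<le> card (hits D0)" for k
  proof -
    \<comment> \<open>Composed with \<open>g\<close>, the truncated script starts at
      \<open>D\<close>, so the maximality of \<open>g\<close> applies to \<open>C k\<close>.\<close>
    have C_eq: "C k = (\<lambda>w. D w - laplacian G (\<lambda>u. g u + max (f u) (M - int k)) w)"
      by (simp add: C_def D0_def laplacian_add diff_diff_eq)
    show ?thesis
      using g_max[of "\<lambda>u. g u + max (f u) (M - int k)"] C_eff[of k]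
      unfolding P_def C_eq[symmetric] D0_def[symmetric] by blast
  qed
  have f_le: "f u \<le> M" if "u \<in> verts G" for u
    using that by (simp add: M_def)
  have "laplacian G (\<lambda>u. max (f u) M) w = laplacian G (\<lambda>u. M) w" for w
    by (rule laplacian_cong) (use f_le in force)
  then have C_0: "C 0 = D0"
    by (simp add: C_def)
  have C_Suc: "C (Suc k) = (\<lambda>w. C k w - laplacian G (\<lambda>u. of_bool (u \<in> U k)) w)" for k
  proof -
    \<comment> \<open>Lowering the cutoff by one adds the indicator of \<open>U k\<close> and
      subtracts 1, and constants have zero Laplacian.\<close>
    have "laplacian G (\<lambda>u. max (f u) (M - int (Suc k))) w
        = laplacian G (\<lambda>u. (max (f u) (M - int k) + of_bool (u \<in> U k)) - 1) w" for w
      by (rule laplacian_cong) (auto simp: U_def)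
    then show ?thesis
      by (simp add: C_def laplacian_add laplacian_diff diff_diff_eq)
  qed
  have U_mono: "U j \<subseteq> U k" if "j \<le> k" for j k
    using that by (auto simp: U_def)
  have deg_C: "div_degree G (C k) = div_degree G D" for k
    by (simp add: C_def D0_def div_degree_def sum_subtractf sum_laplacian)
  \<comment> \<open>At this cutoff, the minimum of \<open>f\<close>, nothing is truncated, so
    \<open>C N\<close> has the promised chip on \<open>v\<close>.\<close>
  define N where "N = nat (M - Min (f ` verts G))"
  have "laplacian G (\<lambda>u. max (f u) (M - int N)) v = laplacian G f v"
  proof (rule laplacian_cong)
    fix u assume "u \<in> verts G"
    then have "Min (f ` verts G) \<le> f u"
      by simp
    moreover have "f u \<le> M" using f_le \<open>u \<in> verts G\<close> .
    ultimately show "max (f u) (M - int N) = f u"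
      by (simp add: N_def)
  qed
  then have "E \<in> hits (C N)"
    using f(2) v(1) E(1) by (auto simp: hits_def C_def intro!: bexI[of _ v])
  moreover have "E \<notin> hits (C 0)"
    using D0_E by (auto simp: hits_def C_0)
  ultimately obtain k where k: "E \<notin> hits (C k)" "E \<in> hits (C (Suc k))"
    using ex_least_nat_less[of "\<lambda>k. E \<in> hits (C k)" N] by blast
  have hits_fin: "finite (hits F)" for F
    using fin_S by (simp add: hits_def)
  \<comment> \<open>Otherwise \<open>E\<close> would be hit on top of all eggs hit by
    \<open>D0\<close>, against the choice of \<open>g\<close>.\<close>
  have "\<not> hits D0 \<subseteq> hits (C (Suc k))"
  proof
    assume "hits D0 \<subseteq> hits (C (Suc k))"
    then have "hits D0 \<subset> hits (C (Suc k))"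
      using k(2) \<open>E \<notin> hits (C 0)\<close> by (auto simp: C_0)
    then show False
      using psubset_card_mono[OF hits_fin] C_max[of "Suc k"] by (meson leD)
  qed
  then obtain E' where E': "E' \<in> hits (C 0)" "E' \<notin> hits (C (Suc k))"
    by (auto simp: C_0)
  \<comment> \<open>\<open>E'\<close> is lost at a step \<open>j\<close> no later than
    \<open>k\<close>. So it lies in \<open>U j\<close>, hence in \<open>U k\<close> as level sets
    grow, whereas \<open>E\<close> avoids \<open>U k\<close>.\<close>
  obtain j where j: "j \<le> k" "E' \<in> hits (C j)" "E' \<notin> hits (C (Suc j))"
    using ex_least_nat_less[of "\<lambda>k. E' \<notin> hits (C k)" "Suc k"] E' by (auto simp: less_Suc_eq_le)
  have zero: "C k v = 0" if "E \<in> S" "E \<notin> hits (C k)" "v \<in> E" for E k v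
    using that egg(2)[of E] C_eff[of k] by (force simp: hits_def effective_def)
  have "E \<inter> U k = {}"
    using unhit_before_firing[OF egg(3,2)[OF E(1)] zero[OF E(1) k(1)] C_Suc C_eff] k(2)
    by (simp add: hits_def)
  then have E_sub: "E \<subseteq> verts G - U k"
    using egg(2)[OF E(1)] by blast
  have "E' \<in> S"
    using E'(1) by (simp add: hits_def)
  have "E' \<subseteq> U j"
    using unhit_after_firing[OF egg(3,2)[OF \<open>E' \<in> S\<close>] zero[OF \<open>E' \<in> S\<close> j(3)] C_Suc C_eff] j(2)
    by (simp add: hits_def)
  then have "E' \<subseteq> U k"
    using U_mono[OF j(1)] by blast
  moreover have "U k \<subseteq> verts G"
    by (auto simp: U_def)
  ultimately have cut: "egg_cut G S (U k) (verts G - U k)"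
    using E_sub E(1) \<open>E' \<in> S\<close> unfolding egg_cut_def by blast
  then have "egg_cut_number G S \<le> card (cut_edges G (U k) (verts G - U k))"
    unfolding egg_cut_number_def by (intro Least_le) blast
  moreover have "int (card (cut_edges G (U k) (verts G - U k))) \<le> div_degree G (C k)"
    using C_eff[of "Suc k"] unfolding C_Suc
    by (intro card_cut_edges_le_degree C_eff) (auto simp: U_def)
  ultimately show False
    using less_cut[OF cut] deg_C[of k] by simp
qed

end

section \<open>Edge boundaries in the rook's graph\<close>

text \<open>For \<open>A\<close> inside the board, this is the number of edges leaving
  \<open>A\<close> in the rook's graph; integer valued, so that later differences are not
  truncated.\<close>

definition rook_boundary :: "'b set \<Rightarrow> 'c set \<Rightarrow> ('b \<times> 'c) set \<Rightarrow> int" where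
  "rook_boundary Q R A = (\<Sum>(y, z)\<in>A. int (card (R - A `` {y})) + int (card (Q - A\<inverse> `` {z})))"

section \<open>Row and column counts on a finite board\<close>

locale rook =
  fixes Q :: "'b set" and R :: "'c set" and n m :: nat
  assumes finite_rows: "finite Q" and finite_cols: "finite R"
    and card_rows: "card Q = n" and card_cols: "card R = m"
begin

lemma finite_board: "A \<subseteq> Q \<times> R \<Longrightarrow> finite A"
  using finite_rows finite_cols by (meson finite_SigmaI finite_subset)

lemma row_bounds:
  assumes "A \<subseteq> Q \<times> R"
  shows "finite (A `` {y})" "card (A `` {y}) \<le> m" "card (R - A `` {y}) = m - card (A `` {y})"
proof -
  have sub: "A `` {y} \<subseteq> R"
    using assms by auto
  show "finite (A `` {y})"
    using sub finite_cols by (rule finite_subset)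
  then show "card (A `` {y}) \<le> m" "card (R - A `` {y}) = m - card (A `` {y})"
    using sub finite_cols card_cols by (auto simp: card_Diff_subset card_mono)
qed

lemma col_bounds:
  assumes "A \<subseteq> Q \<times> R"
  shows "finite (A\<inverse> `` {z})" "card (A\<inverse> `` {z}) \<le> n" "card (Q - A\<inverse> `` {z}) = n - card (A\<inverse> `` {z})"
proof -
  have sub: "A\<inverse> `` {z} \<subseteq> Q"
    using assms by auto
  show "finite (A\<inverse> `` {z})"
    using sub finite_rows by (rule finite_subset)
  then show "card (A\<inverse> `` {z}) \<le> n" "card (Q - A\<inverse> `` {z}) = n - card (A\<inverse> `` {z})"
    using sub finite_rows card_rows by (auto simp: card_Diff_subset card_mono)
qed

lemma card_le_board: "A \<subseteq> Q \<times> R \<Longrightarrow> card A \<le> n * m"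
  using card_mono[of "Q \<times> R" A] finite_rows finite_cols card_rows card_cols
  by (simp add: card_cartesian_product)

lemma card_complement: "A \<subseteq> Q \<times> R \<Longrightarrow> card (Q \<times> R - A) = n * m - card A"
  using card_Diff_subset[of A "Q \<times> R"] finite_board card_rows card_cols
  by (simp add: card_cartesian_product)

lemma sum_rows:
  fixes f :: "'b \<Rightarrow> int"
  assumes "A \<subseteq> Q \<times> R"
  shows "(\<Sum>(y, z)\<in>A. f y) = (\<Sum>y\<in>Q. int (card (A `` {y})) * f y)"
proof -
  have "A = (SIGMA y:Q. A `` {y})"
    using assms by auto
  then have "(\<Sum>(y, z)\<in>A. f y) = (\<Sum>(y, z)\<in>(SIGMA y:Q. A `` {y}). f y)"
    by simp
  also have "\<dots> = (\<Sum>y\<in>Q. \<Sum>z\<in>A `` {y}. f y)"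
    by (subst sum.Sigma) (use finite_rows row_bounds(1)[OF assms] in auto)
  finally show ?thesis by simp
qed

lemma rook_converse: "rook R Q m n"
  using finite_rows finite_cols card_rows card_cols by unfold_locales

lemma sum_cols:
  fixes f :: "'c \<Rightarrow> int"
  assumes "A \<subseteq> Q \<times> R"
  shows "(\<Sum>(y, z)\<in>A. f z) = (\<Sum>z\<in>R. int (card (A\<inverse> `` {z})) * f z)"
proof -
  have "(\<Sum>(y, z)\<in>A. f z) = (\<Sum>(z, y)\<in>A\<inverse>. f z)"
    by (rule sum.reindex_bij_witness[where i = prod.swap and j = prod.swap]) auto
  also have "\<dots> = (\<Sum>z\<in>R. int (card (A\<inverse> `` {z})) * f z)"
    by (rule rook.sum_rows[OF rook_converse]) (use assms in auto)
  finally show ?thesis .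
qed

text \<open>In a row with \<open>r\<close> cells of \<open>A\<close>, each of them sees the
  \<open>m - r\<close> missing ones; likewise for columns.\<close>

lemma rook_boundary_eq:
  assumes "A \<subseteq> Q \<times> R"
  shows "rook_boundary Q R A
    = (\<Sum>y\<in>Q. int (card (A `` {y})) * (int m - int (card (A `` {y}))))
    + (\<Sum>z\<in>R. int (card (A\<inverse> `` {z})) * (int n - int (card (A\<inverse> `` {z}))))"
  unfolding rook_boundary_def
  by (simp add: case_prod_unfold sum.distrib row_bounds[OF assms] col_bounds[OF assms] of_nat_diff
      flip: sum_rows[OF assms] sum_cols[OF assms])

lemma rook_boundary_complement:
  assumes "A \<subseteq> Q \<times> R"
  shows "rook_boundary Q R (Q \<times> R - A) = rook_boundary Q R A"
proof -
  have "(Q \<times> R - A) `` {y} = R - A `` {y}" if "y \<in> Q" for y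
    using that by auto
  moreover have "(Q \<times> R - A)\<inverse> `` {z} = Q - A\<inverse> `` {z}" if "z \<in> R" for z
    using that by auto
  ultimately show ?thesis
    using rook_boundary_eq[OF assms] rook_boundary_eq[of "Q \<times> R - A"]
      row_bounds[OF assms] col_bounds[OF assms]
    by (simp add: of_nat_diff algebra_simps)
qed

section \<open>Edge isoperimetry on one board\<close>

text \<open>The row and the column of a cell overlap only there, so the numbers of cells of
  \<open>A\<close> in them add up to at most \<open>card A + 1\<close>; the rest of
  \<open>m + n\<close> leads outside.\<close>

lemma rook_boundary_ge_small:
  assumes A: "A \<subseteq> Q \<times> R"
  shows "int (card A) * (int m + int n - 1 - int (card A)) \<le> rook_boundary Q R A"
proof -
  have fin: "finite A"
    using A by (rule finite_board)
  have "int m + int n - 1 - int (card A)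
      \<le> int (card (R - A `` {y})) + int (card (Q - A\<inverse> `` {z}))" if "(y, z) \<in> A" for y z
  proof -
    let ?r = "{y} \<times> A `` {y}" and ?c = "A\<inverse> `` {z} \<times> {z}"
    have "card ?r + card ?c = card (?r \<union> ?c) + card (?r \<inter> ?c)"
      using row_bounds(1)[OF A] col_bounds(1)[OF A] by (intro card_Un_Int) auto
    moreover have "card (?r \<union> ?c) \<le> card A"
      using fin by (intro card_mono) auto
    moreover have "card (?r \<inter> ?c) \<le> card {(y, z)}"
      by (intro card_mono) auto
    ultimately show ?thesis
      using row_bounds(2,3)[OF A, of y] col_bounds(2,3)[OF A, of z]
      by (simp add: card_cartesian_product)
  qed
  then have "(\<Sum>(y, z)\<in>A. int m + int n - 1 - int (card A)) \<le> rook_boundary Q R A"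
    unfolding rook_boundary_def by (intro sum_mono) auto
  then show ?thesis
    by (simp add: case_prod_unfold)
qed

text \<open>By concavity a line neither empty nor full contributes least when just one of its cells
  is present or missing.\<close>

lemma split_line_ge:
  fixes r l :: int
  assumes "1 \<le> r" "r < l"
  shows "l - 1 \<le> r * (l - r)"
proof -
  have "0 \<le> (r - 1) * (l - r - 1)"
    using assms by (intro mult_nonneg_nonneg) auto
  then show ?thesis by (simp add: algebra_simps)
qed

text \<open>\<open>A\<close> occupies \<open>p\<close> rows and \<open>q\<close> columns, not all of
  either. If \<open>p + q\<close> is small, each cell has at least \<open>n - 1\<close> neighbours
  in the empty lines; otherwise there are many occupied lines, none of them full.\<close>

lemma rook_boundary_ge_empty_lines:
  assumes A: "A \<subseteq> Q \<times> R" and "n \<le> m" "m \<le> card A"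
    and "y0 \<in> Q" "A `` {y0} = {}" and "z0 \<in> R" "A\<inverse> `` {z0} = {}"
  shows "int m * (int n - 1) \<le> rook_boundary Q R A"
proof -
  define p where "p = card (Domain A)"
  define q where "q = card (Range A)"
  have dom: "Domain A \<subseteq> Q - {y0}" and rng: "Range A \<subseteq> R - {z0}"
    using assms by auto
  have fin: "finite (Domain A)" "finite (Range A)"
    using finite_board[OF A] by (auto intro: finite_Domain finite_Range)
  have n: "1 \<le> n" and m: "1 \<le> m"
    using assms(4,6) finite_rows finite_cols card_rows card_cols
    by (metis One_nat_def Suc_leI card_gt_0_iff empty_iff)+
  have p: "p < n" and q: "q < m"
    using card_mono[OF _ dom] card_mono[OF _ rng] assms(4,6) n m
    by (auto simp: p_def q_def finite_rows finite_cols card_rows card_cols)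
  have r: "card (A `` {y}) \<le> q" and c: "card (A\<inverse> `` {z}) \<le> p" for y z
    unfolding p_def q_def using fin by (auto intro!: card_mono)
  show ?thesis
  proof (cases "p + q \<le> m + 1")
    case True
    have "int m * (int n - 1) \<le> int (card A) * (int m - int q + int n - int p)"
      using True assms(3) n by (intro mult_mono) auto
    also have "\<dots> = (\<Sum>(y, z)\<in>A. int m - int q + int n - int p)"
      by (simp add: case_prod_unfold)
    also have "\<dots> \<le> rook_boundary Q R A"
      unfolding rook_boundary_def
    proof (intro sum_mono, clarify)
      fix y z
      show "int m - int q + int n - int p \<le> int (card (R - A `` {y})) + int (card (Q - A\<inverse> `` {z}))"
        using r[of y] c[of z] row_bounds(2,3)[OF A, of y] col_bounds(2,3)[OF A, of z]
        by (simp add: of_nat_diff)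
    qed
    finally show ?thesis .
  next
    case False
    have "int p * (int n - 1) \<le> int p * (int m - 1)"
      using assms(2) by (intro mult_left_mono) auto
    also have "\<dots> = (\<Sum>y\<in>Domain A. int m - 1)"
      by (simp add: p_def)
    also have "\<dots> \<le> (\<Sum>y\<in>Domain A. int (card (A `` {y})) * (int m - int (card (A `` {y}))))"
    proof (rule sum_mono, rule split_line_ge)
      fix y assume "y \<in> Domain A"
      then have "A `` {y} \<noteq> {}" by auto
      then show "1 \<le> int (card (A `` {y}))"
        using row_bounds(1)[OF A, of y] by (simp add: Suc_le_eq card_gt_0_iff)
      show "int (card (A `` {y})) < int m"
        using r[of y] q by simp
    qed
    also have "\<dots> \<le> (\<Sum>y\<in>Q. int (card (A `` {y})) * (int m - int (card (A `` {y}))))"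
      using dom finite_rows row_bounds(2)[OF A] by (intro sum_mono2) auto
    finally have rows: "int p * (int n - 1) \<le> \<dots>" .
    have "int q * (int n - 1) = (\<Sum>z\<in>Range A. int n - 1)"
      by (simp add: q_def)
    also have "\<dots> \<le> (\<Sum>z\<in>Range A. int (card (A\<inverse> `` {z})) * (int n - int (card (A\<inverse> `` {z}))))"
    proof (rule sum_mono, rule split_line_ge)
      fix z assume "z \<in> Range A"
      then have "A\<inverse> `` {z} \<noteq> {}" by auto
      then show "1 \<le> int (card (A\<inverse> `` {z}))"
        using col_bounds(1)[OF A, of z] by (simp add: Suc_le_eq card_gt_0_iff)
      show "int (card (A\<inverse> `` {z})) < int n"
        using c[of z] p by simp
    qed
    also have "\<dots> \<le> (\<Sum>z\<in>R. int (card (A\<inverse> `` {z})) * (int n - int (card (A\<inverse> `` {z}))))"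
      using rng finite_cols col_bounds(2)[OF A] by (intro sum_mono2) auto
    finally have "(int p + int q) * (int n - 1) \<le> rook_boundary Q R A"
      using rows by (simp add: rook_boundary_eq[OF A] distrib_right)
    moreover have "int m * (int n - 1) \<le> (int p + int q) * (int n - 1)"
      using False n by (intro mult_right_mono) auto
    ultimately show ?thesis by simp
  qed
qed

text \<open>If all columns or all rows are split, adding up these lines suffices. Otherwise an
  unsplit row crosses an unsplit column, and the common cell decides whether both are empty or both
  full; complementing turns full into empty.\<close>

lemma rook_boundary_ge_medium:
  assumes A: "A \<subseteq> Q \<times> R" and "n \<le> m" "m \<le> card A" "card A + m \<le> n * m"
  shows "int m * (int n - 1) \<le> rook_boundary Q R A"
proof -
  have rows_nonneg: "0 \<le> (\<Sum>y\<in>Q. int (card (A `` {y})) * (int m - int (card (A `` {y}))))"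
    using row_bounds(2)[OF A] by (intro sum_nonneg) auto
  have cols_nonneg: "0 \<le> (\<Sum>z\<in>R. int (card (A\<inverse> `` {z})) * (int n - int (card (A\<inverse> `` {z}))))"
    using col_bounds(2)[OF A] by (intro sum_nonneg) auto
  consider "\<forall>z\<in>R. A\<inverse> `` {z} \<noteq> {} \<and> A\<inverse> `` {z} \<noteq> Q" | "\<forall>y\<in>Q. A `` {y} \<noteq> {} \<and> A `` {y} \<noteq> R"
    | y0 z0 where "y0 \<in> Q" "z0 \<in> R" "A `` {y0} = {} \<or> A `` {y0} = R" "A\<inverse> `` {z0} = {} \<or> A\<inverse> `` {z0} = Q"
    by blast
  then show ?thesis
  proof cases
    case 1
    have "int m * (int n - 1) = (\<Sum>z\<in>R. int n - 1)"
      by (simp add: card_cols)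
    also have "\<dots> \<le> (\<Sum>z\<in>R. int (card (A\<inverse> `` {z})) * (int n - int (card (A\<inverse> `` {z}))))"
    proof (rule sum_mono, rule split_line_ge)
      fix z assume "z \<in> R"
      then show "1 \<le> int (card (A\<inverse> `` {z}))"
        using 1 col_bounds(1)[OF A, of z] by (simp add: Suc_le_eq card_gt_0_iff)
      have "A\<inverse> `` {z} \<subset> Q"
        using 1 \<open>z \<in> R\<close> A by auto
      then show "int (card (A\<inverse> `` {z})) < int n"
        using psubset_card_mono[OF finite_rows] card_rows by simp
    qed
    finally show ?thesis
      using rows_nonneg by (simp add: rook_boundary_eq[OF A])
  next
    case 2
    have "int m * (int n - 1) \<le> int n * (int m - 1)"
      using assms(2) by (simp add: algebra_simps)
    also have "\<dots> = (\<Sum>y\<in>Q. int m - 1)"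
      by (simp add: card_rows)
    also have "\<dots> \<le> (\<Sum>y\<in>Q. int (card (A `` {y})) * (int m - int (card (A `` {y}))))"
    proof (rule sum_mono, rule split_line_ge)
      fix y assume "y \<in> Q"
      then show "1 \<le> int (card (A `` {y}))"
        using 2 row_bounds(1)[OF A, of y] by (simp add: Suc_le_eq card_gt_0_iff)
      have "A `` {y} \<subset> R"
        using 2 \<open>y \<in> Q\<close> A by auto
      then show "int (card (A `` {y})) < int m"
        using psubset_card_mono[OF finite_cols] card_cols by simp
    qed
    finally show ?thesis
      using cols_nonneg by (simp add: rook_boundary_eq[OF A])
  next
    case 3
    show ?thesis
    proof (cases "(y0, z0) \<in> A")
      case False
      then have "A `` {y0} = {}" "A\<inverse> `` {z0} = {}"
        using 3 by auto
      then show ?thesis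
        using rook_boundary_ge_empty_lines[OF A] assms 3 by blast
    next
      case True
      then have "(Q \<times> R - A) `` {y0} = {}" "(Q \<times> R - A)\<inverse> `` {z0} = {}"
        using 3 by auto
      moreover have "m \<le> card (Q \<times> R - A)"
        using assms(4) by (simp add: card_complement[OF A])
      ultimately have "int m * (int n - 1) \<le> rook_boundary Q R (Q \<times> R - A)"
        using rook_boundary_ge_empty_lines[of "Q \<times> R - A"] assms(2) 3(1,2) by blast
      then show ?thesis
        by (simp add: rook_boundary_complement[OF A])
    qed
  qed
qed

text \<open>One bound for all sizes, symmetric under complementation; its factor \<open>m\<close>
  lets the bounds of two layers be added.\<close>

lemma rook_boundary_ge:
  assumes A: "A \<subseteq> Q \<times> R" and "n \<le> m" "1 \<le> n"
  shows "int m * min (min (int (card A)) (int n - 1)) (int n * int m - int (card A)) \<le> rook_boundary Q R A"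
proof -
  have small: "int m * min (int (card B)) (int n - 1) \<le> rook_boundary Q R B"
    if B: "B \<subseteq> Q \<times> R" "card B \<le> m" for B
  proof (cases "card B \<le> n - 1")
    case True
    then have "int (card B) * int m \<le> int (card B) * (int m + int n - 1 - int (card B))"
      using assms(3) by (intro mult_left_mono) auto
    moreover have "min (int (card B)) (int n - 1) = int (card B)"
      using True assms(3) by auto
    ultimately show ?thesis
      using rook_boundary_ge_small[OF B(1)] by (simp add: mult.commute)
  next
    case False
    \<comment> \<open>The concave quadratic \<open>b * (m + n - 1 - b)\<close> equals
      \<open>m * (n - 1)\<close> at \<open>b = n - 1\<close> and at \<open>b = m\<close>.\<close>
    then have "0 \<le> (int (card B) - (int n - 1)) * (int m - int (card B))"
      using B(2) by (intro mult_nonneg_nonneg) auto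
    then have "int m * (int n - 1) \<le> int (card B) * (int m + int n - 1 - int (card B))"
      by (simp add: algebra_simps)
    moreover have "min (int (card B)) (int n - 1) = int n - 1"
      using False by auto
    ultimately show ?thesis
      using rook_boundary_ge_small[OF B(1)] by simp
  qed
  have le: "int (card A) \<le> int n * int m"
    using card_le_board[OF A] by (metis of_nat_le_iff of_nat_mult)
  consider "card A \<le> m" | "n * m \<le> card A + m" | "m \<le> card A" "card A + m \<le> n * m"
    by linarith
  then show ?thesis
  proof cases
    case 1
    have "int m * min (min (int (card A)) (int n - 1)) (int n * int m - int (card A))
        \<le> int m * min (int (card A)) (int n - 1)"
      by (intro mult_left_mono) auto
    then show ?thesis using small[OF A 1] by linarith
  next
    case 2
    have "int (card (Q \<times> R - A)) = int n * int m - int (card A)"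
      using le card_le_board[OF A] by (simp add: card_complement[OF A] of_nat_diff)
    moreover have "int m * min (int (card (Q \<times> R - A))) (int n - 1) \<le> rook_boundary Q R (Q \<times> R - A)"
      using 2 by (intro small) (auto simp: card_complement[OF A])
    moreover have "int m * min (min (int (card A)) (int n - 1)) (int n * int m - int (card A))
        \<le> int m * min (int n * int m - int (card A)) (int n - 1)"
      by (intro mult_left_mono) auto
    ultimately show ?thesis
      by (simp add: rook_boundary_complement[OF A])
  next
    case 3
    have "int m * min (min (int (card A)) (int n - 1)) (int n * int m - int (card A))
        \<le> int m * (int n - 1)"
      by (intro mult_left_mono) auto
    then show ?thesis using rook_boundary_ge_medium[OF A assms(2) 3] by linarith
  qed
qed

section \<open>Edge isoperimetry on two stacked boards\<close>

text \<open>With the other layer empty, all \<open>card A\<close> rungs between the layers are cut.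
  For \<open>a = card A\<close> up to \<open>m\<close> the total is at least
  \<open>a * (m + n - a)\<close>, which is \<open>n * m\<close> at \<open>a = n\<close> and
  \<open>a = m\<close>; beyond, the general bound suffices.\<close>

lemma two_layer_boundary_ge_empty_layer:
  assumes A: "A \<subseteq> Q \<times> R" and "n \<le> m" "1 \<le> n" "n \<le> card A"
  shows "int (n * m) \<le> rook_boundary Q R A + int (card A)"
proof (cases "card A \<le> m")
  case True
  then have "0 \<le> (int (card A) - int n) * (int m - int (card A))"
    using assms(4) by (intro mult_nonneg_nonneg) auto
  then show ?thesis
    using rook_boundary_ge_small[OF A] by (simp add: algebra_simps)
next
  case False
  have le: "int (card A) \<le> int n * int m"
    using card_le_board[OF A] by (metis of_nat_le_iff of_nat_mult)
  show ?thesis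
  proof (cases "int n - 1 \<le> int n * int m - int (card A)")
    case True
    then show ?thesis
      using rook_boundary_ge[OF A assms(2,3)] False assms(4) by (simp add: algebra_simps min_def split: if_splits)
  next
    case big: False
    have "1 * (int n * int m - int (card A)) \<le> int m * (int n * int m - int (card A))"
      using le assms(2,3) by (intro mult_right_mono) auto
    then show ?thesis
      using rook_boundary_ge[OF A assms(2,3)] big assms(4) by (simp add: min_def split: if_splits)
  qed
qed

text \<open>The size conditions say that both sides of a cut have at least \<open>n\<close>
  vertices; the two set differences count the cut rungs.\<close>

lemma two_layer_boundary_ge:
  assumes A: "A \<subseteq> Q \<times> R" and B: "B \<subseteq> Q \<times> R" and nm: "n \<le> m" "2 \<le> n"
    and "n \<le> card A + card B" "card A + card B + n \<le> 2 * (n * m)"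
  shows "int (n * m) \<le> rook_boundary Q R A + rook_boundary Q R B + int (card (A - B)) + int (card (B - A))"
proof -
  have fin: "finite A" "finite B"
    using A B finite_board by auto
  let ?N = "int n * int m"
  have le: "int (card A) \<le> ?N" "int (card B) \<le> ?N"
    using card_le_board A B by (metis of_nat_le_iff of_nat_mult)+
  have empty: "rook_boundary Q R {} = 0"
    by (simp add: rook_boundary_def)
  then have full: "rook_boundary Q R (Q \<times> R) = 0"
    using rook_boundary_complement[of "{}"] by simp
  \<comment> \<open>A full layer reduces to an empty one by complementing both layers.\<close>
  have extreme: "int (n * m) \<le> rook_boundary Q R C + rook_boundary Q R D + int (card (C - D)) + int (card (D - C))"
    if C: "C = {} \<or> C = Q \<times> R" and D: "D \<subseteq> Q \<times> R"
      and "n \<le> card C + card D" "card C + card D + n \<le> 2 * (n * m)" for C D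
    using C
  proof
    assume "C = {}"
    then show ?thesis
      using two_layer_boundary_ge_empty_layer[OF D] that(3) nm empty by simp
  next
    assume C: "C = Q \<times> R"
    have "card C = n * m"
      by (simp add: C card_cartesian_product card_rows card_cols)
    then have "n \<le> card (Q \<times> R - D)"
      using that(4) unfolding card_complement[OF D] by linarith
    then have "int (n * m) \<le> rook_boundary Q R (Q \<times> R - D) + int (card (Q \<times> R - D))"
      using nm by (intro two_layer_boundary_ge_empty_layer) auto
    then show ?thesis
      by (simp add: C full rook_boundary_complement[OF D])
  qed
  show ?thesis
  proof (cases "A = {} \<or> A = Q \<times> R \<or> B = {} \<or> B = Q \<times> R")
    case True
    then show ?thesis
      using extreme[of A B] extreme[of B A] A B assms(5,6) by (auto simp: add.commute add.left_commute)
  next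
    case False
    have "card A \<noteq> 0" "card B \<noteq> 0"
      using False fin by auto
    moreover have "card (Q \<times> R - A) \<noteq> 0" "card (Q \<times> R - B) \<noteq> 0"
      using False A B finite_rows finite_cols by auto
    ultimately have bounds: "1 \<le> int (card A)" "1 \<le> int (card B)" "int (card A) \<le> ?N - 1" "int (card B) \<le> ?N - 1"
      using le card_le_board[OF A] card_le_board[OF B]
      by (auto simp: card_complement[OF A] card_complement[OF B] simp flip: of_nat_mult)
    \<comment> \<open>Neither layer being empty or full, both values of this profile are at least
      1.\<close>
    let ?\<mu> = "\<lambda>s. min (min s (int n - 1)) (?N - s)"
    have diff: "int (card A) - int (card B) \<le> int (card (A - B))" "int (card B) - int (card A) \<le> int (card (B - A))"
      using diff_card_le_card_Diff[OF fin(2), of A] diff_card_le_card_Diff[OF fin(1), of B] by linarith+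
    define k where "k = ?\<mu> (int (card A)) + ?\<mu> (int (card B))"
    have lower: "int m * k \<le> rook_boundary Q R A + rook_boundary Q R B"
      using rook_boundary_ge[OF A] rook_boundary_ge[OF B] nm by (simp add: k_def distrib_left)
    show ?thesis
    proof (cases "int n \<le> k")
      case True
      then have "int m * int n \<le> int m * k"
        by (intro mult_left_mono) auto
      then show ?thesis
        using lower by (simp add: mult.commute)
    next
      case False
      have N: "2 * int n \<le> ?N"
        using nm by (auto intro: mult_mono simp: mult.commute)
      have "int (card A) + int (card B) + int n \<le> 2 * ?N"
        using assms(6) by (simp flip: of_nat_mult of_nat_add)
      \<comment> \<open>Both profile values are positive and \<open>k < n\<close>, so neither is
        \<open>n - 1\<close>. The size conditions forbid two nearly empty or two nearly full layers;
        so there is one of each, and they differ in at least \<open>?N - k\<close> cells.\<close>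
      then have "k = int (card A) + (?N - int (card B)) \<or> k = int (card B) + (?N - int (card A))"
        using False bounds assms(5) N nm by (auto simp: k_def min_def split: if_splits)
      then have "?N \<le> k + int (card (A - B)) + int (card (B - A))"
        using diff by linarith
      moreover have "1 * k \<le> int m * k"
        using bounds nm by (intro mult_right_mono) (auto simp: k_def min_def)
      ultimately show ?thesis
        using lower by simp
    qed
  qed
qed

section \<open>Large crosses in more than half of a board\<close>

text \<open>Summing row size plus column size over the cells of \<open>A\<close> gives the sum of
  the squares of all line sizes. This is too large for every summand to be at most
  \<open>n\<close>.\<close>

lemma exists_large_cross:
  assumes A: "A \<subseteq> Q \<times> R" and "n \<le> m" "n * m < 2 * card A"
  shows "\<exists>(y, z)\<in>A. n < card (A `` {y}) + card (A\<inverse> `` {z})"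
proof (rule ccontr)
  let ?r = "\<lambda>y. int (card (A `` {y}))" and ?c = "\<lambda>z. int (card (A\<inverse> `` {z}))"
  \<comment> \<open>The tangent to the square at \<open>k / 2\<close>, cleared of denominators;
    \<open>k\<close> will be the length of a row or column, as half-filled lines are the critical
    case.\<close>
  have square: "4 * (a * k) - k * k \<le> 4 * (a * a)" for a k :: int
    using zero_le_power2[of "2 * a - k"] by (simp add: power2_eq_square algebra_simps)
  have card_rows_sum: "(\<Sum>y\<in>Q. ?r y) = int (card A)" "(\<Sum>z\<in>R. ?c z) = int (card A)"
    using sum_rows[OF A, of "\<lambda>_. 1"] sum_cols[OF A, of "\<lambda>_. 1"] by (simp_all add: case_prod_unfold)
  assume "\<not> ?thesis"
  then have "(\<Sum>(y, z)\<in>A. ?r y + ?c z) \<le> (\<Sum>(y, z)\<in>A. int n)"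
    by (intro sum_mono) force
  then have upper: "(\<Sum>y\<in>Q. ?r y * ?r y) + (\<Sum>z\<in>R. ?c z * ?c z) \<le> int n * int (card A)"
    using sum_rows[OF A, of ?r] sum_cols[OF A, of ?c]
    by (simp add: case_prod_unfold sum.distrib mult.commute)
  have "(\<Sum>y\<in>Q. 4 * (?r y * int m) - int m * int m) \<le> (\<Sum>y\<in>Q. 4 * (?r y * ?r y))"
    by (intro sum_mono square)
  then have rows: "4 * int (card A) * int m - int n * (int m * int m) \<le> 4 * (\<Sum>y\<in>Q. ?r y * ?r y)"
    by (simp add: sum_subtractf card_rows card_rows_sum flip: sum_distrib_left sum_distrib_right)
  have "(\<Sum>z\<in>R. 4 * (?c z * int n) - int n * int n) \<le> (\<Sum>z\<in>R. 4 * (?c z * ?c z))"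
    by (intro sum_mono square)
  then have cols: "4 * int (card A) * int n - int m * (int n * int n) \<le> 4 * (\<Sum>z\<in>R. ?c z * ?c z)"
    by (simp add: sum_subtractf card_cols card_rows_sum flip: sum_distrib_left sum_distrib_right)
  have "4 * int (card A) * int m \<le> int n * (int m * int m) + int m * (int n * int n)"
    using upper rows cols by (simp add: algebra_simps)
  also have "\<dots> = int m * (int n * (int m + int n))"
    by (simp add: algebra_simps)
  also have "\<dots> \<le> int m * (int n * (int m + int m))"
    using assms(2) by (intro mult_left_mono) auto
  finally have "int m * (2 * int (card A)) \<le> int m * (int n * int m)"
    by (simp add: algebra_simps)
  moreover have "0 < int m"
    using assms A card_cols finite_cols by (cases m) auto
  ultimately have "2 * int (card A) \<le> int n * int m"
    by simp
  then show False
    using assms(3) by (simp flip: of_nat_mult)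
qed

end

section \<open>The product of an edge with a rook's graph\<close>

text \<open>These stars need not be induced: further edges among the leaves are allowed.\<close>

definition stars :: "('a, 'b) pre_digraph \<Rightarrow> nat \<Rightarrow> 'a set set" where
  "stars G k = {E. E \<subseteq> verts G \<and> k \<le> card E \<and> (\<exists>v\<in>E. \<forall>u\<in>E. u \<noteq> v \<longrightarrow> (v, u) \<in> arcs_ends G)}"

text \<open>Any two vertices are joined through the centre, which also keeps the egg non-empty for
  \<open>k = 0\<close>.\<close>

lemma (in graph) scramble_stars: "scramble G (stars G k)"
  unfolding scramble_def
proof (intro ballI conjI)
  fix E assume "E \<in> stars G k"
  then obtain v where E: "E \<subseteq> verts G" "v \<in> E" "\<And>u. u \<in> E \<Longrightarrow> u \<noteq> v \<Longrightarrow> (v, u) \<in> arcs_ends G"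
    by (auto simp: stars_def)
  let ?r = "(arcs_ends (G \<restriction> E))\<^sup>s"
  have ends: "(u, w) \<in> ?r" if "(u, w) \<in> arcs_ends G" "u \<in> E" "w \<in> E" for u w
    using that by (auto simp: arcs_ends_def arc_to_ends_def symcl_def)
  have from_v: "(v, u) \<in> rtrancl_on E ?r" and to_v: "(u, v) \<in> rtrancl_on E ?r" if "u \<in> E" for u
    using that E ends[of v u] ends[of u v] arcs_ends_sym[of u v]
    by (cases "u = v"; blast intro: rtrancl_on_into_rtrancl_on rtrancl_on_refl)+
  show "E \<noteq> {}" "E \<subseteq> verts G"
    using E by auto
  show "connected (G \<restriction> E)"
    using E(2) from_v to_v by (auto simp: connected_conv intro: rtrancl_on_trans)
qed

text \<open>\<open>LEAST\<close> is informative only with a witness: the whole vertex set is a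
  hitting set since eggs are non-empty, and egg cuts count only if one exists.\<close>

lemma scramble_order_ge:
  assumes "scramble G S"
    and hit: "\<And>H. hitting_set G S H \<Longrightarrow> k \<le> card H"
    and cut: "\<And>X Y. egg_cut G S X Y \<Longrightarrow> k \<le> card (cut_edges G X Y)"
  shows "k \<le> scramble_order G S"
proof -
  have "hitting_set G S (verts G)"
    using assms(1) by (auto simp: scramble_def hitting_set_def)
  then have "\<exists>j H. hitting_set G S H \<and> card H = j"
    by blast
  then have "\<exists>H. hitting_set G S H \<and> card H = hitting_number G S"
    unfolding hitting_number_def by (rule LeastI_ex)
  then have "k \<le> hitting_number G S"
    using hit by metis
  moreover have "k \<le> egg_cut_number G S" if "\<exists>X Y. egg_cut G S X Y"
  proof -
    have "\<exists>j X Y. egg_cut G S X Y \<and> card (cut_edges G X Y) = j"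
      using that by blast
    then have "\<exists>X Y. egg_cut G S X Y \<and> card (cut_edges G X Y) = egg_cut_number G S"
      unfolding egg_cut_number_def by (rule LeastI_ex)
    then show ?thesis
      using cut by metis
  qed
  ultimately show ?thesis
    by (simp add: scramble_order_def)
qed

section \<open>Layers of the product\<close>

definition layer :: "(('a \<times> 'b) \<times> 'c) set \<Rightarrow> 'a \<Rightarrow> ('b \<times> 'c) set" where
  "layer X x = {(y, z). ((x, y), z) \<in> X}"

lemma mem_layer [simp]: "(y, z) \<in> layer X x \<longleftrightarrow> ((x, y), z) \<in> X"
  by (simp add: layer_def)

locale double_rook =
  fixes A :: "('a, 'd) pre_digraph" and B :: "('b, 'e) pre_digraph" and C :: "('c, 'f) pre_digraph"
    and n m :: nat and x0 x1 :: 'a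
  assumes complete_A: "K\<^bsub>2\<^esub> A" and complete_B: "K\<^bsub>n\<^esub> B" and complete_C: "K\<^bsub>m\<^esub> C"
    and verts_A: "verts A = {x0, x1}" and x0_x1: "x0 \<noteq> x1"
    and n_ge: "2 \<le> n" and n_le_m: "n \<le> m"
begin

lemma graph_factors: "graph A" "graph B" "graph C"
  using complete_A complete_B complete_C by (auto simp: complete_digraph_def)

sublocale graph "A \<box> B \<box> C"
  by (intro graph_cart_prod graph_factors)

sublocale rook "verts B" "verts C" n m
proof -
  interpret B: graph B by (rule graph_factors)
  interpret C: graph C by (rule graph_factors)
  show "rook (verts B) (verts C) n m"
    using complete_B complete_C by unfold_locales (auto simp: complete_digraph_def)
qed

abbreviation "G \<equiv> A \<box> B \<box> C"

lemma arcs_ends_G: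
  "(((x, y), z), ((x', y'), z')) \<in> arcs_ends G \<longleftrightarrow>
     x \<in> verts A \<and> x' \<in> verts A \<and> y \<in> verts B \<and> y' \<in> verts B \<and> z \<in> verts C \<and> z' \<in> verts C \<and>
     (x = x' \<and> y = y' \<and> z \<noteq> z' \<or> x = x' \<and> y \<noteq> y' \<and> z = z' \<or> x \<noteq> x' \<and> y = y' \<and> z = z')"
  using complete_A complete_B complete_C
  by (auto simp: arcs_ends_cart_prod complete_digraph_def)

lemma layer_subset: "X \<subseteq> verts G \<Longrightarrow> layer X x \<subseteq> verts B \<times> verts C"
  by auto

lemma sum_layers:
  fixes f :: "('a \<times> 'b) \<times> 'c \<Rightarrow> int"
  assumes X: "X \<subseteq> verts G"
  shows "(\<Sum>v\<in>X. f v) = (\<Sum>(y, z)\<in>layer X x0. f ((x0, y), z)) + (\<Sum>(y, z)\<in>layer X x1. f ((x1, y), z))"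
proof -
  let ?emb = "\<lambda>x (y, z). ((x, y), z)"
  have inj: "inj_on (?emb x) S" for x S
    by (auto simp: inj_on_def)
  have split: "X = ?emb x0 ` layer X x0 \<union> ?emb x1 ` layer X x1"
    using X verts_A by (auto simp: layer_def image_iff split_paired_Ex)
  have fin: "finite (layer X x)" for x
    using finite_board layer_subset[OF X] by blast
  have "(\<Sum>v\<in>X. f v) = (\<Sum>v\<in>?emb x0 ` layer X x0. f v) + (\<Sum>v\<in>?emb x1 ` layer X x1. f v)"
    by (subst split, rule sum.union_disjoint) (use fin x0_x1 in auto)
  moreover have "(\<Sum>v\<in>?emb x ` L. f v) = (\<Sum>(y, z)\<in>L. f ((x, y), z))" for x L
    unfolding sum.reindex[OF inj] by (simp add: case_prod_unfold comp_def)
  ultimately show ?thesis by simp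
qed

lemma card_layers:
  assumes "X \<subseteq> verts G"
  shows "card X = card (layer X x0) + card (layer X x1)"
  using sum_layers[OF assms, of "\<lambda>_. 1"] by (simp add: case_prod_unfold flip: of_nat_add)

lemma card_verts: "card (verts G) = 2 * (n * m)"
  using verts_A x0_x1 card_rows card_cols by (simp add: card_cartesian_product)

text \<open>The summands are the outside neighbours along the row, along the column and across the
  rung. Variable \<open>x\<close> and \<open>x'\<close> serve both layers.\<close>

lemma card_neighbours_outside:
  assumes X: "X \<subseteq> verts G" and v: "((x, y), z) \<in> X" and x: "verts A = {x, x'}" "x \<noteq> x'"
  shows "int (card {u. (((x, y), z), u) \<in> arcs_ends G \<and> u \<in> verts G - X})
    = int (card (verts C - layer X x `` {y})) + int (card (verts B - (layer X x)\<inverse> `` {z}))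
      + of_bool ((y, z) \<notin> layer X x')"
proof -
  let ?S = "(\<lambda>z'. ((x, y), z')) ` (verts C - layer X x `` {y})"
  let ?T = "(\<lambda>y'. ((x, y'), z)) ` (verts B - (layer X x)\<inverse> `` {z})"
  let ?U = "if (y, z) \<notin> layer X x' then {((x', y), z)} else {}"
  have yz: "y \<in> verts B" "z \<in> verts C"
    using X v by auto
  have "{u. (((x, y), z), u) \<in> arcs_ends G \<and> u \<in> verts G - X} = ?S \<union> ?T \<union> ?U"
    using X v x yz by (auto simp: arcs_ends_G image_iff split: if_splits)
  moreover have "card (?S \<union> ?T \<union> ?U) = card ?S + card ?T + card ?U"
  proof -
    have "?S \<inter> ?T = {}"
      using v by auto
    moreover have "(?S \<union> ?T) \<inter> ?U = {}"
      using x(2) by auto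
    ultimately show ?thesis
      using finite_rows finite_cols by (simp add: card_Un_disjoint)
  qed
  moreover have "card ?S = card (verts C - layer X x `` {y})"
    by (rule card_image) (auto simp: inj_on_def)
  moreover have "card ?T = card (verts B - (layer X x)\<inverse> `` {z})"
    by (rule card_image) (auto simp: inj_on_def)
  ultimately show ?thesis
    by auto
qed

text \<open>Edges cut inside a layer form its rook boundary; a rung is cut exactly when its cell
  lies in one layer of \<open>X\<close> only.\<close>

lemma card_cut_layers:
  assumes X: "X \<subseteq> verts G"
  shows "int (card (cut_edges G X (verts G - X)))
    = rook_boundary (verts B) (verts C) (layer X x0) + rook_boundary (verts B) (verts C) (layer X x1)
      + int (card (layer X x0 - layer X x1)) + int (card (layer X x1 - layer X x0))"
proof -
  let ?b = "\<lambda>x y z. int (card (verts C - layer X x `` {y})) + int (card (verts B - (layer X x)\<inverse> `` {z}))"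
  have fin: "finite (layer X x)" for x
    using finite_board layer_subset[OF X] by blast
  have diff: "(\<Sum>(y, z)\<in>L. of_bool ((y, z) \<notin> L')) = int (card (L - L'))" if "finite L" for L L' :: "('b \<times> 'c) set"
  proof -
    have "(\<Sum>(y, z)\<in>L. of_bool ((y, z) \<notin> L')) = (\<Sum>p\<in>L. if p \<notin> L' then 1 else (0::int))"
      by (rule sum.cong) auto
    also have "\<dots> = int (card (L - L'))"
      using that by (simp add: set_diff_eq flip: sum.inter_filter)
    finally show ?thesis .
  qed
  have finX: "finite X"
    using X finite_verts by (rule finite_subset)
  have swap: "verts A = {x1, x0}" "x1 \<noteq> x0"
    using verts_A x0_x1 by auto
  have "int (card (cut_edges G X (verts G - X)))
      = (\<Sum>v\<in>X. int (card {u. (v, u) \<in> arcs_ends G \<and> u \<in> verts G - X}))"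
    unfolding card_cut_edges[OF finX] by simp
  also have "\<dots> = (\<Sum>(y, z)\<in>layer X x0. int (card {u. (((x0, y), z), u) \<in> arcs_ends G \<and> u \<in> verts G - X}))
      + (\<Sum>(y, z)\<in>layer X x1. int (card {u. (((x1, y), z), u) \<in> arcs_ends G \<and> u \<in> verts G - X}))"
    by (rule sum_layers[OF X])
  also have "\<dots> = (\<Sum>(y, z)\<in>layer X x0. ?b x0 y z + of_bool ((y, z) \<notin> layer X x1))
      + (\<Sum>(y, z)\<in>layer X x1. ?b x1 y z + of_bool ((y, z) \<notin> layer X x0))"
    by (intro arg_cong2[where f = "(+)"] sum.cong refl)
       (clarify, rule card_neighbours_outside[OF X _ verts_A x0_x1] card_neighbours_outside[OF X _ swap], simp)+
  also have "(\<Sum>(y, z)\<in>layer X x0. ?b x0 y z + of_bool ((y, z) \<notin> layer X x1))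
      = rook_boundary (verts B) (verts C) (layer X x0) + int (card (layer X x0 - layer X x1))"
    unfolding rook_boundary_def diff[OF fin, symmetric] sum.distrib[symmetric] by (rule sum.cong) auto
  also have "(\<Sum>(y, z)\<in>layer X x1. ?b x1 y z + of_bool ((y, z) \<notin> layer X x0))
      = rook_boundary (verts B) (verts C) (layer X x1) + int (card (layer X x1 - layer X x0))"
    unfolding rook_boundary_def diff[OF fin, symmetric] sum.distrib[symmetric] by (rule sum.cong) auto
  finally show ?thesis by simp
qed

section \<open>Order of the scramble of stars\<close>

lemma stars_hitting_set_ge:
  assumes H: "hitting_set G (stars G n) H"
  shows "n * m \<le> card H"
proof (rule ccontr)
  assume less: "\<not> n * m \<le> card H"
  let ?W = "verts G - H"
  have H_sub: "H \<subseteq> verts G"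
    using H by (simp add: hitting_set_def)
  have "card ?W = 2 * (n * m) - card H"
    using card_Diff_subset[OF finite_subset[OF H_sub finite_verts] H_sub] card_verts by simp
  then have "n * m < card (layer ?W x0) + card (layer ?W x1)"
    using less card_layers[of ?W] by (simp del: cart_prod_simps)
  then have "n * m < 2 * card (layer ?W x0) \<or> n * m < 2 * card (layer ?W x1)"
    by linarith
  then obtain x where x: "x \<in> verts A" "n * m < 2 * card (layer ?W x)"
    using verts_A by blast
  let ?L = "layer ?W x"
  have L: "?L \<subseteq> verts B \<times> verts C"
    by (rule layer_subset) simp
  obtain y z where yz: "(y, z) \<in> ?L" "n < card (?L `` {y}) + card (?L\<inverse> `` {z})"
    using exists_large_cross[OF L n_le_m x(2)] by auto
  let ?r = "{y} \<times> ?L `` {y}" and ?c = "?L\<inverse> `` {z} \<times> {z}"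
  let ?E = "(\<lambda>(y, z). ((x, y), z)) ` (?r \<union> ?c)"
  \<comment> \<open>Row and column share the centre alone, so the strict inequality pays for
    counting it twice.\<close>
  have "card ?r + card ?c = card (?r \<union> ?c) + card (?r \<inter> ?c)"
    using row_bounds(1)[OF L] col_bounds(1)[OF L] by (intro card_Un_Int) auto
  moreover have "card (?r \<inter> ?c) \<le> card {(y, z)}"
    by (intro card_mono) auto
  ultimately have "n \<le> card (?r \<union> ?c)"
    using yz(2) by (simp add: card_cartesian_product)
  also have "\<dots> = card ?E"
    by (rule card_image[symmetric]) (auto simp: inj_on_def)
  finally have "n \<le> card ?E" .
  moreover have "?E \<subseteq> ?W"
    by auto
  moreover have "((x, y), z) \<in> ?E"
    using yz(1) by force
  moreover have "\<forall>u\<in>?E. u \<noteq> ((x, y), z) \<longrightarrow> (((x, y), z), u) \<in> arcs_ends G"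
    using yz(1) x(1) by (auto simp: arcs_ends_G)
  ultimately have "?E \<in> stars G n"
    unfolding stars_def by blast
  then have "H \<inter> ?E \<noteq> {}"
    using H by (simp add: hitting_set_def)
  then show False
    using \<open>?E \<subseteq> ?W\<close> by blast
qed

lemma stars_egg_cut_ge:
  assumes cut: "egg_cut G (stars G n) X Y"
  shows "n * m \<le> card (cut_edges G X Y)"
proof -
  have X: "X \<subseteq> verts G" and Y: "Y = verts G - X"
    using cut unfolding egg_cut_def by blast+
  have fin: "finite X" "finite Y"
    using X Y finite_verts finite_subset by auto
  obtain E1 E2 where "E1 \<subseteq> X" "E2 \<subseteq> Y" "n \<le> card E1" "n \<le> card E2"
    using cut by (auto simp: egg_cut_def stars_def)
  then have "n \<le> card X" "n \<le> card Y"
    using card_mono fin by (meson order_trans)+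
  moreover have "card X + card Y = 2 * (n * m)"
    using X Y fin card_verts card_Diff_subset[OF fin(1) X] card_mono[OF finite_verts X] by simp
  ultimately have "int (n * m) \<le> int (card (cut_edges G X Y))"
    unfolding Y card_cut_layers[OF X] using card_layers[OF X] n_le_m n_ge
    by (intro two_layer_boundary_ge layer_subset X) auto
  then show ?thesis
    by (simp only: of_nat_le_iff)
qed

lemma scramble_order_stars_ge: "n * m \<le> scramble_order G (stars G n)"
  by (intro scramble_order_ge scramble_stars stars_hitting_set_ge stars_egg_cut_ge)

section \<open>The divisor filling one layer\<close>

definition layer_divisor :: "'a \<Rightarrow> ('a \<times> 'b) \<times> 'c \<Rightarrow> int" where
  "layer_divisor x v = of_bool (v \<in> ({x} \<times> verts B) \<times> verts C)"

lemma layer_divisor_in_divisors: "x \<in> verts A \<Longrightarrow> layer_divisor x \<in> divisors G"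
  by (auto simp: divisors_def layer_divisor_def)

lemma degree_layer_divisor:
  assumes "x \<in> verts A"
  shows "div_degree G (layer_divisor x) = int (n * m)"
proof -
  have "div_degree G (layer_divisor x) = (\<Sum>v\<in>({x} \<times> verts B) \<times> verts C. 1)"
    unfolding div_degree_def
    by (rule sum.mono_neutral_cong_right)
       (use assms verts_A finite_verts in \<open>auto simp: layer_divisor_def\<close>)
  then show ?thesis
    by (simp add: card_cartesian_product card_rows card_cols)
qed

text \<open>Every vertex has exactly one neighbour in the opposite layer, so one chip moves along
  each rung.\<close>

lemma fire_layer:
  "layer_divisor x0 w - laplacian G (\<lambda>u. of_bool (u \<in> ({x0} \<times> verts B) \<times> verts C)) w = layer_divisor x1 w"
proof -
  let ?U = "({x0} \<times> verts B) \<times> verts C"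
  obtain x y z where w: "w = ((x, y), z)"
    by (metis surj_pair)
  consider "w \<in> ?U" | "w \<in> ({x1} \<times> verts B) \<times> verts C" | "w \<notin> verts G"
    using verts_A w by auto
  then show ?thesis
  proof cases
    case 1
    then have "x = x0" "y \<in> verts B" "z \<in> verts C"
      by (simp_all add: w)
    then have "((w, ((x', y'), z')) \<in> arcs_ends G \<and> ((x', y'), z') \<notin> ?U) \<longleftrightarrow> ((x', y'), z') = ((x1, y), z)" for x' y' z'
      using x0_x1 by (auto simp add: arcs_ends_G w verts_A)
    then have "{u. (w, u) \<in> arcs_ends G \<and> u \<notin> ?U} = {((x1, y), z)}"
      unfolding set_eq_iff split_paired_All by simp
    then have "laplacian G (\<lambda>u. of_bool (u \<in> ?U)) w = 1"
      using laplacian_indicator_in[OF 1] by simp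
    moreover have "layer_divisor x0 w = 1" "layer_divisor x1 w = 0"
      using 1 x0_x1 unfolding w by (auto simp: layer_divisor_def)
    ultimately show ?thesis by linarith
  next
    case 2
    then have "w \<notin> ?U"
      using x0_x1 by auto
    moreover have "x = x1" "y \<in> verts B" "z \<in> verts C"
      using 2 by (simp_all add: w)
    then have "((w, ((x', y'), z')) \<in> arcs_ends G \<and> ((x', y'), z') \<in> ?U) \<longleftrightarrow> ((x', y'), z') = ((x0, y), z)" for x' y' z'
      using x0_x1 by (auto simp add: arcs_ends_G w verts_A)
    then have "{u. (w, u) \<in> arcs_ends G \<and> u \<in> ?U} = {((x0, y), z)}"
      unfolding set_eq_iff split_paired_All by simp
    ultimately have "laplacian G (\<lambda>u. of_bool (u \<in> ?U)) w = - 1"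
      using laplacian_indicator_notin[of w ?U] by simp
    moreover have "layer_divisor x0 w = 0" "layer_divisor x1 w = 1"
      using 2 x0_x1 unfolding w by (auto simp: layer_divisor_def)
    ultimately show ?thesis by linarith
  next
    case 3
    then have "layer_divisor x0 w = 0" "layer_divisor x1 w = 0"
      using verts_A unfolding w by (auto simp: layer_divisor_def)
    then show ?thesis
      using laplacian_notin_verts[OF 3] by simp
  qed
qed

lemma rank_layer_divisor: "rank_at_least G (layer_divisor x0) 1"
  unfolding rank_at_least_def
proof (intro ballI impI, elim conjE)
  fix E assume E: "E \<in> divisors G" "effective G E" "div_degree G E = int 1"
  \<comment> \<open>An effective divisor of degree 1 is a single chip, sitting where its value is
    nonzero.\<close>
  obtain v where v: "v \<in> verts G" "E v \<noteq> 0"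
    using E(3) unfolding div_degree_def by (metis of_nat_1 sum.neutral zero_neq_one)
  have "1 = E v + (\<Sum>w\<in>verts G - {v}. E w)"
    using E(3) sum.remove[OF finite_verts v(1), of E] by (simp add: div_degree_def)
  moreover have nonneg: "\<And>w. w \<in> verts G - {v} \<Longrightarrow> 0 \<le> E w"
    using E(2) unfolding effective_def by blast
  moreover have "1 \<le> E v"
    using E(2) v by (force simp: effective_def)
  ultimately have Ev: "E v = 1" and "(\<Sum>w\<in>verts G - {v}. E w) = 0"
    using sum_nonneg[of "verts G - {v}" E] by auto
  then have E0: "E w = 0" if "w \<in> verts G" "w \<noteq> v" for w
    using that sum_nonneg_eq_0_iff[of "verts G - {v}" E] nonneg finite_verts by blast
  \<comment> \<open>The layer containing \<open>v\<close> can afford to lose that chip.\<close>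
  have good: "(\<lambda>w. layer_divisor x w - E w) \<in> divisors G \<and> effective G (\<lambda>w. layer_divisor x w - E w)"
    if "x \<in> verts A" "v \<in> ({x} \<times> verts B) \<times> verts C" for x
  proof
    show "(\<lambda>w. layer_divisor x w - E w) \<in> divisors G"
      using layer_divisor_in_divisors[OF that(1)] E(1) by (simp add: divisors_def)
    show "effective G (\<lambda>w. layer_divisor x w - E w)"
      unfolding effective_def
    proof
      fix w assume "w \<in> verts G"
      then show "0 \<le> layer_divisor x w - E w"
        using E0[of w] Ev that(2) by (cases "w = v") (simp_all add: layer_divisor_def)
    qed
  qed
  show "\<exists>F\<in>divisors G. effective G F \<and> div_equiv G (\<lambda>w. layer_divisor x0 w - E w) F"
  proof (cases "v \<in> ({x0} \<times> verts B) \<times> verts C")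
    case True
    then show ?thesis
      using good[of x0] verts_A by (auto simp: div_equiv_def)
  next
    case False
    let ?U = "({x0} \<times> verts B) \<times> verts C"
    have "layer_divisor x0 w - E w - laplacian G (\<lambda>u. of_bool (u \<in> ?U)) w = layer_divisor x1 w - E w" for w
      using fire_layer[of w] by linarith
    then have eq: "(\<lambda>w. layer_divisor x0 w - E w - laplacian G (\<lambda>u. of_bool (u \<in> ?U)) w)
        = (\<lambda>w. layer_divisor x1 w - E w)"
      by (rule ext)
    have "?U \<subseteq> verts G"
      using verts_A by auto
    from firing_steps_set[OF this, of "\<lambda>w. layer_divisor x0 w - E w"]
    have "(firing_step G)\<^sup>*\<^sup>* (\<lambda>w. layer_divisor x0 w - E w) (\<lambda>w. layer_divisor x1 w - E w)"
      unfolding eq .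
    then have "div_equiv G (\<lambda>w. layer_divisor x0 w - E w) (\<lambda>w. layer_divisor x1 w - E w)"
      by (simp add: div_equiv_def)
    moreover have "v \<in> ({x1} \<times> verts B) \<times> verts C"
      using False v(1) verts_A by auto
    ultimately show ?thesis
      using good[of x1] verts_A by blast
  qed
qed

lemma verts_G_nonempty: "verts G \<noteq> {}"
proof
  assume "verts G = {}"
  then show False
    using card_verts n_ge n_le_m by (simp del: cart_prod_simps)
qed

section \<open>Gonality and scramble number\<close>

lemma gon_eq: "gon G = int (n * m)"
  unfolding gon_def
proof (rule Least_equality)
  show "\<exists>D\<in>divisors G. div_degree G D = int (n * m) \<and> rank_at_least G D 1"
    using layer_divisor_in_divisors degree_layer_divisor rank_layer_divisor verts_A by blast
next
  fix d assume "\<exists>D\<in>divisors G. div_degree G D = d \<and> rank_at_least G D 1"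
  then have "int (scramble_order G (stars G n)) \<le> d"
    using scramble_order_le_degree[OF scramble_stars _ verts_G_nonempty] by blast
  moreover have "int (n * m) \<le> int (scramble_order G (stars G n))"
    unfolding of_nat_le_iff by (rule scramble_order_stars_ge)
  ultimately show "int (n * m) \<le> d"
    by linarith
qed

text \<open>No order exceeds the degree of the layer divisor, and the stars reach it;
  \<open>Max\<close> is taken over a finite set of orders.\<close>

lemma sn_eq: "sn G = n * m"
proof -
  have le: "scramble_order G S \<le> n * m" if "scramble G S" for S
  proof -
    have "div_degree G (layer_divisor x0) = int (n * m)"
      using degree_layer_divisor verts_A by blast
    then show ?thesis
      using scramble_order_le_degree[OF that rank_layer_divisor verts_G_nonempty]
      by (simp only: of_nat_le_iff)
  qed
  have "scramble_order G (stars G n) = n * m"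
    using le[OF scramble_stars] scramble_order_stars_ge by (rule antisym)
  then have "n * m \<in> {scramble_order G S | S. scramble G S}"
    by (intro CollectI exI[of _ "stars G n"]) (simp add: scramble_stars)
  then show ?thesis
    unfolding sn_def using le finite_scramble_orders[OF finite_verts]
    by (intro Max_eqI) auto
qed

end

theorem theorem1p3:
  fixes n m :: nat
    and A :: "('a, 'd) pre_digraph" and B :: "('b, 'e) pre_digraph" and C :: "('c, 'f) pre_digraph"
  assumes "2 \<le> n" and "n \<le> m"
    and "K\<^bsub>2\<^esub> A" and "K\<^bsub>n\<^esub> B" and "K\<^bsub>m\<^esub> C"
  shows "int (sn (A \<box> B \<box> C)) = gon (A \<box> B \<box> C) \<and> gon (A \<box> B \<box> C) = int (n * m)"
proof -
  obtain x0 x1 where "verts A = {x0, x1}" "x0 \<noteq> x1"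
    using assms(3) by (auto simp: complete_digraph_def card_2_iff)
  then interpret double_rook A B C n m x0 x1
    using assms by unfold_locales
  show ?thesis
    by (simp add: sn_eq gon_eq)
qed

end
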